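(* For all real numbers $a$ and $b$ with $a>0$ and $b<0$, there exist a finite time $T>0$ and a $C^\infty$-solution $S(t,z,\bar z)$, $(t,x)\in[0,T)\times\mathbf{R}^2$, of the Schrödinger map equation from $\mathbf{R}^2$ to the hyperbolic 2-space $\mathbf{H}^2$, $$S_t=-\tfrac12[S,S_{z\bar z}],\qquad S=\begin{pmatrix} is_3 & s_1+is_2\\ s_1-is_2 & -is_3\end{pmatrix},\quad s_1,s_2,s_3\text{ real},\quad s_1^2+s_2^2-s_3^2=-1,\ s_3<0,$$ such that $|\nabla S|$ blows up in finite time at every point of $\mathbf{R}^2$ except the origin, i.e. $|\nabla S|(t,x)\to+\infty$ as $t\to T^-$ for every $x\in\mathbf{R}^2\setminus\{0\}$.
   Context: Coordinates on $\mathbf{R}^2$ are $(x_1,x_2)$, with $z=\frac{x_1+ix_2}{2}$ and $\bar z=\frac{x_1-ix_2}{2}$ (note the nonstandard factor $\frac12$), so that $\partial_z=\partial_{x_1}-i\partial_{x_2}$, $\partial_{\bar z}=\partial_{x_1}+i\partial_{x_2}$ and $\partial_z\partial_{\bar z}=\partial_{x_1}^2+\partial_{x_2}^2$. Functions of $(t,z,\bar z)$ are just functions of $(t,x_1,x_2)$, and $[X,Y]=XY-YX$. Here $$|\nabla S|:=\sum_{j=1}^3\bigl(|(s_j)_z|+|(s_j)_{\bar z}|\bigr).$$ The matrix equation is the matrix form of the Schrödinger map equation for maps $\mathbf{s}=(s_1,s_2,s_3)$ into the sheet $s_3<0$ of the hyperboloid $s_1^2+s_2^2-s_3^2=-1$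 in $\mathbf{R}^{2+1}$, a model of $\mathbf{H}^2$. *)

theory Defs
  imports "HOL-Analysis.Analysis"
begin

text \<open>
  \<open>Ck_on k D f\<close> is the class C^k on \<open>D\<close>, with derivatives taken within \<open>D\<close> (so one-sided at boundary
  points belonging to \<open>D\<close>). It is meant for sets \<open>D\<close> on which the Frechet derivative within \<open>D\<close> is
  unique at every point, such as convex sets with nonempty interior; elsewhere
  \<^const>\<open>frechet_derivative\<close> is an arbitrary choice.
\<close>

primrec Ck_on :: "nat \<Rightarrow> 'a::real_normed_vector set \<Rightarrow> ('a \<Rightarrow> 'b::real_normed_vector) \<Rightarrow> bool" where
  "Ck_on 0 D f \<longleftrightarrow> continuous_on D f"
| "Ck_on (Suc k) D f \<longleftrightarrow>
     f differentiable_on D \<and> (\<forall>v. Ck_on k D (\<lambda>p. frechet_derivative f (at p within D) v))"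

definition smooth_on :: "'a::real_normed_vector set \<Rightarrow> ('a \<Rightarrow> 'b::real_normed_vector) \<Rightarrow> bool" where
  "smooth_on D f \<longleftrightarrow> (\<forall>k. Ck_on k D f)"

definition partial_x :: "2 \<Rightarrow> (real^2 \<Rightarrow> complex) \<Rightarrow> real^2 \<Rightarrow> complex" where
  "partial_x j f x = vector_derivative (\<lambda>h. f (x + h *\<^sub>R axis j 1)) (at 0)"

text \<open>
  Wirtinger derivatives for \<open>z = (x\<^sub>1 + i x\<^sub>2) / 2\<close>: because of this normalisation of \<open>z\<close> the usual
  factor 1/2 is absent, and \<open>d_zbar (d_z f)\<close> is the Laplacian of \<open>f\<close>.
\<close>

definition d_z :: "(real^2 \<Rightarrow> complex) \<Rightarrow> real^2 \<Rightarrow> complex" where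
  "d_z f x = partial_x 1 f x - \<i> * partial_x 2 f x"

definition d_zbar :: "(real^2 \<Rightarrow> complex) \<Rightarrow> real^2 \<Rightarrow> complex" where
  "d_zbar f x = partial_x 1 f x + \<i> * partial_x 2 f x"

definition mat_z_zbar :: "(real^2 \<Rightarrow> complex^2^2) \<Rightarrow> real^2 \<Rightarrow> complex^2^2" where
  "mat_z_zbar S x = (\<chi> i j. d_zbar (d_z (\<lambda>y. S y $ i $ j)) x)"

definition commutator :: "complex^2^2 \<Rightarrow> complex^2^2 \<Rightarrow> complex^2^2" where
  "commutator X Y = X ** Y - Y ** X"

definition hyperbolic_plane :: "(real^3) set" where
  "hyperbolic_plane = {s. (s$1)\<^sup>2 + (s$2)\<^sup>2 - (s$3)\<^sup>2 = -1 \<and> s$3 < 0}"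

definition spin_matrix :: "real^3 \<Rightarrow> complex^2^2" where
  "spin_matrix s = vector
     [vector [\<i> * of_real (s$3), of_real (s$1) + \<i> * of_real (s$2)],
      vector [of_real (s$1) - \<i> * of_real (s$2), - (\<i> * of_real (s$3))]]"

definition schroedinger_map_solution ::
  "real \<Rightarrow> (real \<Rightarrow> real^2 \<Rightarrow> real^3) \<Rightarrow> (real \<Rightarrow> real^2 \<Rightarrow> complex^2^2) \<Rightarrow> bool" where
  "schroedinger_map_solution T s S \<longleftrightarrow>
     smooth_on ({0..<T} \<times> UNIV) (\<lambda>(t, x). S t x) \<and>
     (\<forall>t\<in>{0..<T}. \<forall>x.
        s t x \<in> hyperbolic_plane \<and>
        S t x = spin_matrix (s t x) \<and>
        ((\<lambda>\<tau>. S \<tau> x) has_vector_derivative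
           - (1/2) *\<^sub>R commutator (S t x) (mat_z_zbar (S t) x)) (at t within {0..<T}))"

definition grad_size :: "(real^2 \<Rightarrow> real^3) \<Rightarrow> real^2 \<Rightarrow> real" where
  "grad_size s x = (\<Sum>j\<in>UNIV. cmod (d_z (\<lambda>y. of_real (s y $ j)) x)
                             + cmod (d_zbar (\<lambda>y. of_real (s y $ j)) x))"

end

theory Submission
  imports Defs "HOL-Real_Asymp.Real_Asymp"
begin

text \<open>
  For maps depending on \<open>x\<close> only through \<open>\<xi> = |x|\<^sup>2\<close>, the equation is solved by a family of
  circles of \<open>H\<^sup>2\<close>: the point \<open>x\<close> is sent to the point of polar angle \<open>- \<beta>(t) \<xi>\<close> on the circle
  of radius \<open>\<rho>(t)\<close>, since curves of constant speed and constant geodesic curvature make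
  the right-hand side a constant normal velocity plus a linear reparametrisation. The system becomes
  \<open>\<beta> = C sinh \<rho>\<close>, \<open>\<rho>' = 4 C sinh\<^sup>2 \<rho>\<close>; with \<open>C = 1/4\<close> it has the solution \<open>coth \<rho> = 2 - t\<close>, that is \<open>sinh \<rho> = amp t\<close>, for
  which \<open>\<rho>\<close> becomes infinite at \<open>t = 1\<close>. The speed \<open>\<beta> sinh \<rho>\<close> with respect to \<open>\<xi>\<close> blows up with it,
  and \<open>\<nabla>\<xi>\<close> vanishes only at the origin.
\<close>

section \<open>Smoothness from a family closed under differentiation\<close>

lemma Ck_on_cong:
  assumes "\<And>p. p \<in> D \<Longrightarrow> f p = g p"
  shows "Ck_on k D f \<longleftrightarrow> Ck_on k D g"
  using assms
proof (induction k arbitrary: f g)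
  case 0
  then show ?case by (simp cong: continuous_on_cong)
next
  case (Suc k)
  have *: "(f has_derivative L) (at p within D) \<longleftrightarrow> (g has_derivative L) (at p within D)"
    if "p \<in> D" for p L
    using that Suc.prems has_derivative_transform[of p D f g L] has_derivative_transform[of p D g f L]
    by metis
  then have "f differentiable_on D \<longleftrightarrow> g differentiable_on D"
    by (simp add: differentiable_on_def differentiable_def)
  \<comment> \<open>\<open>frechet_derivative\<close> is a choice from the candidates satisfying
    \<open>has_derivative\<close>. By \<open>*\<close> the candidates for \<open>f\<close> and
    \<open>g\<close> coincide on \<open>D\<close>, hence so do the choices.\<close>
  moreover have "Ck_on k D (\<lambda>p. frechet_derivative f (at p within D) v)
             \<longleftrightarrow> Ck_on k D (\<lambda>p. frechet_derivative g (at p within D) v)" for v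
    by (intro Suc.IH) (simp add: frechet_derivative_def *)
  ultimately show ?case by simp
qed

text \<open>If every directional derivative of a member of \<open>F\<close> is again in
  \<open>F\<close>, induction on \<open>k\<close> makes all members C^k. Assumption
  \<open>uniq\<close> lets \<open>D\<close> accumulate at each of its points along every axis, so
  the derivative within \<open>D\<close> is unique and the one picked by \<open>Ck_on\<close> is the
  given \<open>f'\<close>. The sign of \<open>d\<close> is free, which admits one-sided boundary
  points such as t = 0.\<close>

lemma smooth_on_coinduct:
  fixes D :: "'a::euclidean_space set" and F :: "('a \<Rightarrow> 'b::real_normed_vector) set"
  assumes uniq: "\<And>p i e. p \<in> D \<Longrightarrow> i \<in> Basis \<Longrightarrow> e > 0 \<Longrightarrow>
                   \<exists>d. 0 < \<bar>d\<bar> \<and> \<bar>d\<bar> < e \<and> p + d *\<^sub>R i \<in> D"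
    and closed: "\<And>f. f \<in> F \<Longrightarrow> \<exists>f'. (\<forall>p\<in>D. (f has_derivative f' p) (at p within D)) \<and>
                   (\<forall>v. (\<lambda>p. f' p v) \<in> F)"
    and "f \<in> F"
  shows "smooth_on D f"
proof -
  have "Ck_on k D f" for k
    using \<open>f \<in> F\<close>
  proof (induction k arbitrary: f)
    case (0 f)
    from closed[OF 0] obtain f' where f': "\<forall>p\<in>D. (f has_derivative f' p) (at p within D)"
      by blast
    then show ?case
      by (auto simp: continuous_on_eq_continuous_within intro: has_derivative_continuous)
  next
    case (Suc k)
    from closed[OF Suc.prems] obtain f' where
      f': "\<And>p. p \<in> D \<Longrightarrow> (f has_derivative f' p) (at p within D)" and F: "\<And>v. (\<lambda>p. f' p v) \<in> F"
      by blast
    have diff: "f differentiable_on D"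
      using f' by (auto simp: differentiable_on_def differentiable_def)
    have eq: "frechet_derivative f (at p within D) = f' p" if "p \<in> D" for p
    proof (rule frechet_derivative_unique_within[OF _ f'[OF that]])
      show "(f has_derivative frechet_derivative f (at p within D)) (at p within D)"
        using f'[OF that] by (metis differentiableI frechet_derivative_works)
    qed (use uniq that in blast)
    have "Ck_on k D (\<lambda>p. frechet_derivative f (at p within D) v)" for v
      using Suc.IH[OF F[of v]] eq by (subst Ck_on_cong[where g = "\<lambda>p. f' p v"]) auto
    with diff show ?case by simp
  qed
  then show ?thesis by (simp add: smooth_on_def)
qed

section \<open>Wirtinger derivatives of radial functions\<close>

lemma has_vector_derivative_radial_axis:
  fixes x :: "real^'n" and h :: "real \<Rightarrow> complex"
  assumes "(h has_vector_derivative h') (at (x \<bullet> x))"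
  shows "((\<lambda>u. h ((x + u *\<^sub>R axis j 1) \<bullet> (x + u *\<^sub>R axis j 1)))
            has_vector_derivative of_real (2 * x$j) * h') (at 0)"
proof -
  let ?l = "\<lambda>u::real. x + u *\<^sub>R axis j 1"
  have "((\<lambda>u. ?l u \<bullet> ?l u) has_vector_derivative 2 * x$j) (at 0)"
    by (auto intro!: derivative_eq_intros
        simp: has_vector_derivative_def inner_axis inner_axis' algebra_simps)
  moreover have "(h has_vector_derivative h') (at (?l 0 \<bullet> ?l 0))" using assms by simp
  ultimately have "((h \<circ> (\<lambda>u. ?l u \<bullet> ?l u)) has_vector_derivative (2 * x$j) *\<^sub>R h') (at 0)"
    by (intro vector_diff_chain_at)
  then show ?thesis
    by (simp add: o_def scaleR_conv_of_real)
qed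

lemma partial_x_radial:
  assumes "(h has_vector_derivative h') (at (x \<bullet> x))"
  shows "partial_x j (\<lambda>y. h (y \<bullet> y)) x = of_real (2 * x$j) * h'"
  unfolding partial_x_def
  by (rule vector_derivative_at[OF has_vector_derivative_radial_axis[OF assms]])

lemma d_z_radial:
  assumes "(h has_vector_derivative h') (at (x \<bullet> x))"
  shows "d_z (\<lambda>y. h (y \<bullet> y)) x = 2 * (of_real (x$1) - \<i> * of_real (x$2)) * h'"
  by (simp add: d_z_def partial_x_radial[OF assms] algebra_simps)

text \<open>The first derivative is 2(x1 - i x2) h'. Applying \<open>d_zbar\<close> to its linear
  factor gives 4, and applying it to h' gives 2(x1 + i x2) h'', where (x1 - i x2)(x1 + i x2) =
  \<xi>. This is the planar Laplacian in the variable \<xi>.\<close>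

lemma d_zbar_d_z_radial:
  assumes h: "\<And>r. (h has_vector_derivative h' r) (at r)"
    and h': "(h' has_vector_derivative h'') (at (x \<bullet> x))"
  shows "d_zbar (d_z (\<lambda>y. h (y \<bullet> y))) x = 4 * h' (x \<bullet> x) + 4 * of_real (x \<bullet> x) * h''"
proof -
  let ?c = "\<lambda>y::real^2. 2 * (of_real (y$1) - \<i> * of_real (y$2)) :: complex"
  have eq: "d_z (\<lambda>y. h (y \<bullet> y)) = (\<lambda>y. ?c y * h' (y \<bullet> y))"
    by (intro ext d_z_radial h)
  \<comment> \<open>\<open>?c\<close> is real linear, so its derivative along an axis is its value
    at the axis vector.\<close>
  have c: "((\<lambda>u. ?c (x + u *\<^sub>R axis j 1)) has_vector_derivative ?c (axis j 1)) (at 0)" for j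
    by (auto intro!: derivative_eq_intros simp: has_vector_derivative_def fun_eq_iff complex_eq_iff)
  have p: "partial_x j (\<lambda>y. ?c y * h' (y \<bullet> y)) x
      = ?c x * (of_real (2 * x$j) * h'') + ?c (axis j 1) * h' (x \<bullet> x)" for j
    unfolding partial_x_def
    by (rule vector_derivative_at)
       (use has_vector_derivative_mult[OF c has_vector_derivative_radial_axis[OF h'], of j] in simp)
  show ?thesis
    unfolding eq d_zbar_def p
    by (simp add: inner_vec_def sum_2 axis_def algebra_simps complex_eq_iff)
qed

section \<open>Matrix identities and the Laplacian of an exponential\<close>

text \<open>Linearity in the coordinates, written as a combination of constant matrices, reduces
  differentiation of the matrix to differentiation of three real functions.\<close>

lemma spin_matrix_vector:
  "spin_matrix (vector [u, v, w]) =
     u *\<^sub>R spin_matrix (axis 1 1) + v *\<^sub>R spin_matrix (axis 2 1) + w *\<^sub>R spin_matrix (axis 3 1)"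
  by (simp add: spin_matrix_def vec_eq_iff forall_2 axis_def complex_eq_iff)

lemma d_zbar_d_z_exp:
  "d_zbar (d_z (\<lambda>y. A * exp (c * of_real (y \<bullet> y)))) x =
     (4 * c + 4 * c\<^sup>2 * of_real (x \<bullet> x)) * (A * exp (c * of_real (x \<bullet> x)))"
proof -
  have d: "((\<lambda>r. A * exp (c * of_real r)) has_vector_derivative c * (A * exp (c * of_real r))) (at r)"
    for A and r :: real
    by (rule has_vector_derivative_real_field) (auto intro!: derivative_eq_intros)
  have d2: "((\<lambda>r. c * (A * exp (c * of_real r))) has_vector_derivative
       c * (c * A * exp (c * of_real (x \<bullet> x)))) (at (x \<bullet> x))"
    using d[of "c * A" "x \<bullet> x"] by (simp add: mult.assoc)
  show ?thesis
    using d_zbar_d_z_radial[OF d d2] by (simp add: power2_eq_square algebra_simps)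
qed

text \<open>The Laplacian of the solution has zero diagonal, since its third coordinate depends on
  time alone; this is the commutator for that shape.\<close>

lemma commutator_off_diagonal:
  "commutator (vector [vector [u, p], vector [p', - u]]) (vector [vector [0, q], vector [q', 0]]) =
     vector [vector [p * q' - q * p', 2 * u * q], vector [- (2 * u * q'), p' * q - q' * p]]"
  by (simp add: commutator_def vec_eq_iff forall_2 matrix_matrix_mult_def sum_2 algebra_simps)

section \<open>The amplitude\<close>

definition amp :: "real \<Rightarrow> real" where
  "amp t = 1 / sqrt ((2 - t)\<^sup>2 - 1)"

text \<open>This is sinh^2 \<rho> (coth^2 \<rho> - 1) = 1 for coth \<rho> = 2 - t; accordingly
  \<open>(2 - t) * amp t\<close> plays the role of cosh \<rho>.\<close>

lemma amp_sqr:
  assumes "t < 1"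
  shows "(amp t)\<^sup>2 * ((2 - t)\<^sup>2 - 1) = 1" "amp t > 0"
proof -
  have "(2 - t)\<^sup>2 - 1 = (1 - t) * (3 - t)" by (simp add: power2_eq_square algebra_simps)
  also have "\<dots> > 0" using assms by simp
  finally show "(amp t)\<^sup>2 * ((2 - t)\<^sup>2 - 1) = 1" "amp t > 0"
    by (simp_all add: amp_def power_divide)
qed

text \<open>In terms of \<rho>: (sinh \<rho>)' = cosh \<rho> sinh^2 \<rho>, because \<rho>' = sinh^2
  \<rho>. The result is polynomial in t and \<open>amp t\<close>, which keeps the algebra below
  closed under differentiation.\<close>

lemma has_real_derivative_amp:
  assumes "t < 1"
  shows "(amp has_real_derivative (2 - t) * amp t ^ 3) (at t within D)"
proof -
  have pos: "(2 - t)\<^sup>2 - 1 > 0"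
    using amp_sqr[OF assms] by (metis zero_less_mult_pos zero_less_one zero_less_power)
  then have "((\<lambda>t. sqrt ((2 - t)\<^sup>2 - 1)) has_real_derivative - ((2 - t) * amp t)) (at t within D)"
    by (auto intro!: derivative_eq_intros simp: amp_def divide_simps)
  from DERIV_inverse'[OF this] pos show ?thesis
    by (simp add: amp_def[abs_def] inverse_eq_divide power3_eq_cube mult_ac)
qed

section \<open>A differential algebra containing the coordinates of the solution\<close>

definition phase :: "real \<times> (real^2) \<Rightarrow> real" where
  "phase p = amp (fst p) / 4 * (snd p \<bullet> snd p)"

text \<open>The algebra is generated so that rule induction proves closure under differentiation.
  The rule \<open>linear\<close> covers t and both coordinates of x at once.\<close>

inductive_set wave_algebra :: "(real \<times> (real^2) \<Rightarrow> real) set" where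
  const: "(\<lambda>p. c) \<in> wave_algebra"
| linear: "bounded_linear l \<Longrightarrow> l \<in> wave_algebra"
| amp: "(\<lambda>p. amp (fst p)) \<in> wave_algebra"
| cos: "(\<lambda>p. cos (phase p)) \<in> wave_algebra"
| sin: "(\<lambda>p. sin (phase p)) \<in> wave_algebra"
| add: "\<lbrakk>f \<in> wave_algebra; g \<in> wave_algebra\<rbrakk> \<Longrightarrow> (\<lambda>p. f p + g p) \<in> wave_algebra"
| mult: "\<lbrakk>f \<in> wave_algebra; g \<in> wave_algebra\<rbrakk> \<Longrightarrow> (\<lambda>p. f p * g p) \<in> wave_algebra"

lemma wave_algebra_uminus: "f \<in> wave_algebra \<Longrightarrow> (\<lambda>p. - f p) \<in> wave_algebra"
  using wave_algebra.mult[OF wave_algebra.const[of "-1"], of f] by simp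

lemma wave_algebra_power: "f \<in> wave_algebra \<Longrightarrow> (\<lambda>p. f p ^ n) \<in> wave_algebra"
  by (induction n) (simp_all add: wave_algebra.const wave_algebra.mult)

lemma wave_algebra_two_minus_fst: "(\<lambda>p. 2 - fst p) \<in> wave_algebra"
  using wave_algebra.add[OF wave_algebra.const[of 2]
      wave_algebra_uminus[OF wave_algebra.linear[OF bounded_linear_fst]]] by simp

lemma wave_algebra_inner_snd: "(\<lambda>p. snd p \<bullet> v) \<in> wave_algebra"
  by (intro wave_algebra.linear bounded_linear_intros)

lemma wave_algebra_snd_sqr: "(\<lambda>p. snd p \<bullet> snd p) \<in> wave_algebra"
proof -
  have "(\<lambda>p. (snd p \<bullet> axis 1 1)\<^sup>2 + (snd p \<bullet> axis 2 1)\<^sup>2) \<in> wave_algebra"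
    by (intro wave_algebra.add wave_algebra_power wave_algebra_inner_snd)
  then show ?thesis
    by (simp add: inner_axis) (simp add: inner_vec_def sum_2 power2_eq_square)
qed

definition phase_deriv :: "real \<times> (real^2) \<Rightarrow> real \<times> (real^2) \<Rightarrow> real" where
  "phase_deriv p v = (2 - fst p) * amp (fst p) ^ 3 * fst v / 4 * (snd p \<bullet> snd p)
     + amp (fst p) / 4 * (2 * (snd p \<bullet> snd v))"

lemma wave_algebra_phase_deriv: "(\<lambda>p. phase_deriv p v) \<in> wave_algebra"
  unfolding phase_deriv_def divide_inverse
  by (intro wave_algebra.intros(1,3,6,7) wave_algebra_power wave_algebra_two_minus_fst
      wave_algebra_inner_snd wave_algebra_snd_sqr)

lemma has_derivative_amp_fst:
  assumes "fst p < 1"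
  shows "((\<lambda>p. amp (fst p)) has_derivative (\<lambda>v. (2 - fst p) * amp (fst p) ^ 3 * fst v))
           (at p within D)"
  using DERIV_compose_FDERIV[OF has_real_derivative_amp[OF assms]
      has_derivative_fst[OF has_derivative_ident]]
  by (simp add: mult_ac)

lemma has_derivative_phase:
  assumes "fst p < 1"
  shows "(phase has_derivative phase_deriv p) (at p within D)"
  unfolding phase_def phase_deriv_def
  by (auto intro!: derivative_eq_intros has_derivative_amp_fst assms
      simp: fun_eq_iff inner_commute field_simps)

text \<open>On generators, differentiation in a fixed direction \<open>v\<close> yields polynomials
  in generators; sums and products follow by linearity and the Leibniz rule.\<close>

lemma wave_algebra_deriv:
  assumes "f \<in> wave_algebra"
  shows "\<exists>f'. (\<forall>p\<in>{0..<1} \<times> UNIV. (f has_derivative f' p) (at p within {0..<1} \<times> UNIV)) \<and>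
           (\<forall>v. (\<lambda>p. f' p v) \<in> wave_algebra)"
  using assms
proof induction
  case (const c)
  then show ?case
    by (intro exI[of _ "\<lambda>_ _. 0"]) (auto intro: wave_algebra.const)
next
  case (linear l)
  then show ?case
    by (intro exI[of _ "\<lambda>_. l"]) (auto intro: wave_algebra.const bounded_linear_imp_has_derivative)
next
  case amp
  show ?case
    by (intro exI[of _ "\<lambda>p v. (2 - fst p) * amp (fst p) ^ 3 * fst v"] conjI ballI allI
        has_derivative_amp_fst wave_algebra.mult wave_algebra_power wave_algebra_two_minus_fst
        wave_algebra.amp wave_algebra.const) auto
next
  case cos
  show ?case
    by (intro exI[of _ "\<lambda>p v. - sin (phase p) * phase_deriv p v"] conjI ballI allI
        wave_algebra.mult wave_algebra_uminus wave_algebra.sin wave_algebra_phase_deriv)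
      (auto intro!: derivative_eq_intros has_derivative_phase)
next
  case sin
  show ?case
    by (intro exI[of _ "\<lambda>p v. cos (phase p) * phase_deriv p v"] conjI ballI allI
        wave_algebra.mult wave_algebra.cos wave_algebra_phase_deriv)
      (auto intro!: derivative_eq_intros has_derivative_phase)
next
  case (add f g)
  then obtain f' g' where
    "\<forall>p\<in>{0..<1} \<times> UNIV. (f has_derivative f' p) (at p within {0..<1} \<times> UNIV)"
    "\<forall>p\<in>{0..<1} \<times> UNIV. (g has_derivative g' p) (at p within {0..<1} \<times> UNIV)"
    "\<And>v. (\<lambda>p. f' p v) \<in> wave_algebra" "\<And>v. (\<lambda>p. g' p v) \<in> wave_algebra"
    by blast
  then show ?case
    by (intro exI[of _ "\<lambda>p v. f' p v + g' p v"] conjI ballI allI has_derivative_add wave_algebra.add)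
      auto
next
  case (mult f g)
  then obtain f' g' where
    "\<forall>p\<in>{0..<1} \<times> UNIV. (f has_derivative f' p) (at p within {0..<1} \<times> UNIV)"
    "\<forall>p\<in>{0..<1} \<times> UNIV. (g has_derivative g' p) (at p within {0..<1} \<times> UNIV)"
    "\<And>v. (\<lambda>p. f' p v) \<in> wave_algebra" "\<And>v. (\<lambda>p. g' p v) \<in> wave_algebra"
    by blast
  with mult.hyps show ?case
    by (intro exI[of _ "\<lambda>p v. f p * g' p v + f' p v * g p"] conjI ballI allI
        has_derivative_mult wave_algebra.add wave_algebra.mult) auto
qed

section \<open>The solution and its smoothness\<close>

text \<open>Polar coordinates on the lower sheet: radius \<rho>, angle minus \<open>phase\<close>,
  height -cosh \<rho>.\<close>

definition spin :: "real \<Rightarrow> real^2 \<Rightarrow> real^3" where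
  "spin t x = vector [amp t * cos (phase (t, x)), - (amp t * sin (phase (t, x))), - ((2 - t) * amp t)]"

lemma smooth_spin: "smooth_on ({0..<1} \<times> UNIV) (\<lambda>(t, x). spin_matrix (spin t x))"
proof (rule smooth_on_coinduct)
  fix p i :: "real \<times> (real^2)" and e :: real
  assume p: "p \<in> {0..<1} \<times> UNIV" and i: "i \<in> Basis" and "e > 0"
  \<comment> \<open>A forward step is possible even at t = 0; the second bound keeps the time below
    1.\<close>
  define d where "d = min (e / 2) ((1 - fst p) / 2)"
  have "0 < d" "d < e" "d < 1 - fst p" using p \<open>e > 0\<close> by (auto simp: d_def min_def)
  moreover have "fst i = 0 \<or> fst i = 1" using i by (auto simp: Basis_prod_def)
  ultimately show "\<exists>d. 0 < \<bar>d\<bar> \<and> \<bar>d\<bar> < e \<and> p + d *\<^sub>R i \<in> {0..<1} \<times> UNIV"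
    using p by (intro exI[of _ d]) (auto simp: mem_Times_iff)
next
  let ?F = "{\<lambda>p. spin_matrix (vector [f p, g p, h p]) | f g h.
               f \<in> wave_algebra \<and> g \<in> wave_algebra \<and> h \<in> wave_algebra}"
  show "(\<lambda>(t, x). spin_matrix (spin t x)) \<in> ?F"
    by (intro CollectI exI[of _ "\<lambda>p. amp (fst p) * cos (phase p)"]
        exI[of _ "\<lambda>p. - (amp (fst p) * sin (phase p))"]
        exI[of _ "\<lambda>p. - ((2 - fst p) * amp (fst p))"] conjI wave_algebra.mult wave_algebra_uminus
        wave_algebra.amp wave_algebra.cos wave_algebra.sin wave_algebra_two_minus_fst)
      (simp add: spin_def fun_eq_iff)
  fix S assume "S \<in> ?F"
  then obtain f g h where S: "S = (\<lambda>p. spin_matrix (vector [f p, g p, h p]))"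
    and fgh: "f \<in> wave_algebra" "g \<in> wave_algebra" "h \<in> wave_algebra" by blast
  from fgh[THEN wave_algebra_deriv] obtain f' g' h' where
    d: "\<And>p. p \<in> {0..<1} \<times> UNIV \<Longrightarrow> (f has_derivative f' p) (at p within {0..<1} \<times> UNIV)"
       "\<And>p. p \<in> {0..<1} \<times> UNIV \<Longrightarrow> (g has_derivative g' p) (at p within {0..<1} \<times> UNIV)"
       "\<And>p. p \<in> {0..<1} \<times> UNIV \<Longrightarrow> (h has_derivative h' p) (at p within {0..<1} \<times> UNIV)" and
    a: "\<And>v. (\<lambda>p. f' p v) \<in> wave_algebra" "\<And>v. (\<lambda>p. g' p v) \<in> wave_algebra"
       "\<And>v. (\<lambda>p. h' p v) \<in> wave_algebra"
    by metis
  have "(S has_derivative (\<lambda>v. spin_matrix (vector [f' p v, g' p v, h' p v])))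
          (at p within {0..<1} \<times> UNIV)" if "p \<in> {0..<1} \<times> UNIV" for p
    unfolding S spin_matrix_vector
    by (intro has_derivative_add has_derivative_scaleR_left d that)
  moreover have "(\<lambda>p. spin_matrix (vector [f' p v, g' p v, h' p v])) \<in> ?F" for v
    by (intro CollectI exI conjI) (rule refl a)+
  ultimately show "\<exists>S'. (\<forall>p\<in>{0..<1} \<times> UNIV. (S has_derivative S' p) (at p within {0..<1} \<times> UNIV)) \<and>
                    (\<forall>v. (\<lambda>p. S' p v) \<in> ?F)"
    by (intro exI[of _ "\<lambda>p v. spin_matrix (vector [f' p v, g' p v, h' p v])"]) blast
qed

section \<open>Verification of the equation\<close>

text \<open>The off-diagonal entries s1 + i s2 and s1 - i s2 are pure exponentials in \<xi>, the
  form that \<open>d_zbar_d_z_exp\<close> handles.\<close>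

lemma exp_phase:
  "of_real (amp t) * exp (- (\<i> * of_real (amp t / 4)) * of_real (x \<bullet> x)) =
     of_real (amp t * cos (phase (t, x))) - \<i> * of_real (amp t * sin (phase (t, x)))"
  "of_real (amp t) * exp (\<i> * of_real (amp t / 4) * of_real (x \<bullet> x)) =
     of_real (amp t * cos (phase (t, x))) + \<i> * of_real (amp t * sin (phase (t, x)))"
proof -
  have "- (\<i> * of_real (amp t / 4)) * of_real (x \<bullet> x) = \<i> * complex_of_real (- phase (t, x))"
       "\<i> * of_real (amp t / 4) * of_real (x \<bullet> x) = \<i> * complex_of_real (phase (t, x))"
    by (simp_all add: phase_def)
  then show
    "of_real (amp t) * exp (- (\<i> * of_real (amp t / 4)) * of_real (x \<bullet> x)) =
     of_real (amp t * cos (phase (t, x))) - \<i> * of_real (amp t * sin (phase (t, x)))"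
    "of_real (amp t) * exp (\<i> * of_real (amp t / 4) * of_real (x \<bullet> x)) =
     of_real (amp t * cos (phase (t, x))) + \<i> * of_real (amp t * sin (phase (t, x)))"
    by (simp_all only: cis_conv_exp[symmetric]) (simp_all add: complex_eq_iff)
qed

text \<open>With c = -i \<open>amp t\<close> / 4, the factor 4c + 4c^2 \<xi> equals -i
  \<open>amp t\<close> - \<open>m\<close>. Here \<open>p\<close> is the entry s1 + i s2; the other
  off-diagonal entry is conjugate, and the diagonal is constant in x.\<close>

lemma mat_z_zbar_spin:
  fixes t x
  defines "m \<equiv> of_real ((amp t)\<^sup>2 * (x \<bullet> x) / 4) :: complex"
    and "p \<equiv> of_real (amp t * cos (phase (t, x))) - \<i> * of_real (amp t * sin (phase (t, x)))"
  shows "mat_z_zbar (\<lambda>x. spin_matrix (spin t x)) x =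
     vector [vector [0, (- \<i> * of_real (amp t) - m) * p],
             vector [(\<i> * of_real (amp t) - m) * cnj p, 0]]"
proof -
  let ?c = "\<i> * of_real (amp t / 4) :: complex"
  have const: "d_zbar (d_z (\<lambda>y. k)) x = 0" for k
    using d_zbar_d_z_radial[of "\<lambda>_. k" "\<lambda>_. 0" 0 x] by simp
  have "spin_matrix (spin t y) $ 1 $ 2 = of_real (amp t) * exp (- ?c * of_real (y \<bullet> y))" for y
    by (subst exp_phase) (simp add: spin_matrix_def spin_def)
  moreover have "spin_matrix (spin t y) $ 2 $ 1 = of_real (amp t) * exp (?c * of_real (y \<bullet> y))" for y
    by (subst exp_phase) (simp add: spin_matrix_def spin_def)
  moreover have "spin_matrix (spin t y) $ 1 $ 1 = - \<i> * of_real ((2 - t) * amp t)"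
    "spin_matrix (spin t y) $ 2 $ 2 = \<i> * of_real ((2 - t) * amp t)" for y
    by (simp_all add: spin_matrix_def spin_def)
  ultimately show ?thesis
    unfolding mat_z_zbar_def
    by (simp only: vec_eq_iff forall_2 vec_lambda_beta vector_2 const d_zbar_d_z_exp)
      (simp only: exp_phase, simp add: m_def p_def power2_eq_square)
qed

text \<open>Write A = \<open>amp t\<close> and p = s1 + i s2 = A exp(-i \<open>phase\<close>). Both
  sides have upper right entry ((2 - t) A^2 - i \<open>?\<theta>'\<close>) p: the real part is A'/A,
  the imaginary part the phase velocity. Both have upper left entry -i A^3.\<close>

lemma spin_time_derivative:
  assumes "t < 1"
  shows "((\<lambda>\<tau>. spin_matrix (spin \<tau> x)) has_vector_derivative
           - (1/2) *\<^sub>R commutator (spin_matrix (spin t x)) (mat_z_zbar (\<lambda>x. spin_matrix (spin t x)) x))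
           (at t within D)"
proof -
  let ?A = "amp t" and ?\<theta> = "phase (t, x)"
  let ?\<theta>' = "(2 - t) * ?A ^ 3 * (x \<bullet> x) / 4"
  note amp' = has_real_derivative_amp[OF assms, of D]
  have phase': "((\<lambda>\<tau>. phase (\<tau>, x)) has_real_derivative ?\<theta>') (at t within D)"
    unfolding phase_def by (auto intro!: derivative_eq_intros amp')
  have d: "((\<lambda>\<tau>. amp \<tau> * cos (phase (\<tau>, x))) has_vector_derivative
          (2 - t) * ?A ^ 3 * cos ?\<theta> - ?A * sin ?\<theta> * ?\<theta>') (at t within D)"
       "((\<lambda>\<tau>. - (amp \<tau> * sin (phase (\<tau>, x)))) has_vector_derivative
          - ((2 - t) * ?A ^ 3 * sin ?\<theta>) - ?A * cos ?\<theta> * ?\<theta>') (at t within D)"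
       "((\<lambda>\<tau>. - ((2 - \<tau>) * amp \<tau>)) has_vector_derivative ?A - (2 - t)\<^sup>2 * ?A ^ 3) (at t within D)"
    unfolding has_real_derivative_iff_has_vector_derivative[symmetric]
    by (auto intro!: derivative_eq_intros amp' phase' simp: power2_eq_square field_simps)
  \<comment> \<open>Inserting the factor 1 from \<open>amp_sqr\<close> cancels the terms with (2 -
    t)^2. This is (cosh \<rho>)' = sinh \<rho> \<rho>' = sinh^3 \<rho>.\<close>
  have "?A - (2 - t)\<^sup>2 * ?A ^ 3 = ?A * (?A\<^sup>2 * ((2 - t)\<^sup>2 - 1)) - (2 - t)\<^sup>2 * ?A ^ 3"
    using amp_sqr(1)[OF assms] by simp
  also have "\<dots> = - (?A ^ 3)" by (simp add: power2_eq_square power3_eq_cube field_simps)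
  finally have "?A - (2 - t)\<^sup>2 * ?A ^ 3 = - (?A ^ 3)" .
  note d = d(1,2) d(3)[unfolded this]
  have "((\<lambda>\<tau>. spin_matrix (spin \<tau> x)) has_vector_derivative
          spin_matrix (vector [(2 - t) * ?A ^ 3 * cos ?\<theta> - ?A * sin ?\<theta> * ?\<theta>',
            - ((2 - t) * ?A ^ 3 * sin ?\<theta>) - ?A * cos ?\<theta> * ?\<theta>', - (?A ^ 3)])) (at t within D)"
    unfolding spin_def spin_matrix_vector
    by (intro has_vector_derivative_add d[THEN bounded_linear.has_vector_derivative[OF bounded_linear_scaleR_left]])
  moreover have "spin_matrix (vector [(2 - t) * ?A ^ 3 * cos ?\<theta> - ?A * sin ?\<theta> * ?\<theta>',
            - ((2 - t) * ?A ^ 3 * sin ?\<theta>) - ?A * cos ?\<theta> * ?\<theta>', - (?A ^ 3)]) =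
     - (1/2) *\<^sub>R commutator (spin_matrix (spin t x)) (mat_z_zbar (\<lambda>x. spin_matrix (spin t x)) x)"
  proof -
    have cs: "(cos ?\<theta>)\<^sup>2 = 1 - (sin ?\<theta>)\<^sup>2" by (simp add: cos_squared_eq)
    \<comment> \<open>In the diagonal of the commutator the terms with \<xi> cancel, leaving a
      multiple of A |p|^2, which this identity turns into A^3.\<close>
    have "?A ^ 3 * (cos ?\<theta>)\<^sup>2 + ?A ^ 3 * (sin ?\<theta>)\<^sup>2 = ?A ^ 3"
      by (simp add: cs algebra_simps)
    then show ?thesis
      unfolding mat_z_zbar_spin
      unfolding spin_matrix_def spin_def vector_3 commutator_off_diagonal
      by (simp add: vec_eq_iff forall_2 complex_eq_iff power2_eq_square power3_eq_cube field_simps)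
  qed
  ultimately show ?thesis by simp
qed

lemma spin_in_hyperbolic_plane:
  assumes "t < 1"
  shows "spin t x \<in> hyperbolic_plane"
proof -
  have "(spin t x $ 1)\<^sup>2 + (spin t x $ 2)\<^sup>2 - (spin t x $ 3)\<^sup>2
      = (amp t)\<^sup>2 * ((cos (phase (t, x)))\<^sup>2 + (sin (phase (t, x)))\<^sup>2) - (2 - t)\<^sup>2 * (amp t)\<^sup>2"
    by (simp add: spin_def power_mult_distrib distrib_left del: sin_cos_squared_add2)
  also have "\<dots> = - ((amp t)\<^sup>2 * ((2 - t)\<^sup>2 - 1))"
    by (simp only: sin_cos_squared_add2 right_diff_distrib) simp
  finally show ?thesis
    using assms amp_sqr[OF assms] by (simp add: hyperbolic_plane_def spin_def)
qed

section \<open>Blow-up of the gradient\<close>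

text \<open>The \<open>d_z\<close> terms of s1 and s2 already suffice, the rest being nonnegative.
  Each may vanish for some phase, but together they carry |sin| + |cos|, which is at least
  1.\<close>

lemma grad_size_spin_ge:
  assumes "t < 1"
  shows "grad_size (spin t) x \<ge> (amp t)\<^sup>2 * norm x / 2"
proof -
  let ?A = "amp t" and ?\<theta> = "phase (t, x)"
  let ?u = "2 * (of_real (x$1) - \<i> * of_real (x$2)) :: complex"
  have u: "cmod ?u = 2 * norm x"
    unfolding norm_mult by (simp add: cmod_def norm_vec_def L2_set_def sum_2)
  have d: "((\<lambda>r. of_real (?A * cos (?A / 4 * r)) :: complex) has_vector_derivative
            of_real (- (?A\<^sup>2 / 4 * sin ?\<theta>))) (at (x \<bullet> x))"
          "((\<lambda>r. of_real (- (?A * sin (?A / 4 * r))) :: complex) has_vector_derivative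
            of_real (- (?A\<^sup>2 / 4 * cos ?\<theta>))) (at (x \<bullet> x))"
    by (auto simp only: of_real_eq_iff intro!: has_vector_derivative_of_real)
      (auto intro!: derivative_eq_intros simp: phase_def power2_eq_square)
  have "d_z (\<lambda>y. of_real (spin t y $ 1)) x = ?u * of_real (- (?A\<^sup>2 / 4 * sin ?\<theta>))"
       "d_z (\<lambda>y. of_real (spin t y $ 2)) x = ?u * of_real (- (?A\<^sup>2 / 4 * cos ?\<theta>))"
    using d[THEN d_z_radial] by (simp_all add: spin_def phase_def)
  then have "cmod (d_z (\<lambda>y. of_real (spin t y $ 1)) x) = 2 * norm x * (?A\<^sup>2 / 4 * \<bar>sin ?\<theta>\<bar>)"
       "cmod (d_z (\<lambda>y. of_real (spin t y $ 2)) x) = 2 * norm x * (?A\<^sup>2 / 4 * \<bar>cos ?\<theta>\<bar>)"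
    by (simp_all only: norm_mult[of ?u] u norm_of_real) (simp_all add: abs_mult)
  then have "grad_size (spin t) x \<ge> ?A\<^sup>2 * norm x / 2 * (\<bar>sin ?\<theta>\<bar> + \<bar>cos ?\<theta>\<bar>)"
    by (simp add: grad_size_def sum_3 algebra_simps)
  moreover have "\<bar>sin ?\<theta>\<bar> + \<bar>cos ?\<theta>\<bar> \<ge> 1"
  proof -
    have "1 = \<bar>sin ?\<theta>\<bar>\<^sup>2 + \<bar>cos ?\<theta>\<bar>\<^sup>2" by simp
    also have "\<dots> \<le> (\<bar>sin ?\<theta>\<bar> + \<bar>cos ?\<theta>\<bar>)\<^sup>2"
      by (simp add: power2_sum)
    finally show ?thesis using power2_le_imp_le[of 1 "\<bar>sin ?\<theta>\<bar> + \<bar>cos ?\<theta>\<bar>"] by simp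
  qed
  moreover have "?A\<^sup>2 * norm x / 2 * (\<bar>sin ?\<theta>\<bar> + \<bar>cos ?\<theta>\<bar>) \<ge> ?A\<^sup>2 * norm x / 2 * 1"
    by (rule mult_left_mono) (use calculation in auto)
  ultimately show ?thesis by simp
qed

text \<open>The denominator (2 - t)^2 - 1 = (1 - t)(3 - t) tends to 0 from above.\<close>

lemma amp_sqr_blowup: "filterlim (\<lambda>t. (amp t)\<^sup>2) at_top (at_left 1)"
proof -
  have "filterlim (\<lambda>t::real. 1 / ((2 - t)\<^sup>2 - 1)) at_top (at_left 1)"
    by real_asymp
  moreover have "\<forall>\<^sub>F t in at_left 1. 1 / ((2 - t)\<^sup>2 - 1) = (amp t)\<^sup>2"
  proof -
    have "1 / ((2 - t)\<^sup>2 - 1) = (amp t)\<^sup>2" if "t < 1" for t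
      using amp_sqr(1)[OF that] by (metis mult_zero_right zero_neq_one nonzero_eq_divide_eq)
    then show ?thesis
      by (auto simp: eventually_at_left_field intro!: exI[of _ 0])
  qed
  ultimately show ?thesis by (rule filterlim_mono_eventually[OF _ order_refl order_refl])
qed

theorem theorem4:
  fixes a b :: real
  assumes "a > 0" and "b < 0"
  shows "\<exists>T>0. \<exists>(s :: real \<Rightarrow> real^2 \<Rightarrow> real^3) S.
           schroedinger_map_solution T s S \<and>
           (\<forall>x. x \<noteq> 0 \<longrightarrow> filterlim (\<lambda>t. grad_size (s t) x) at_top (at_left T))"
proof -
  \<comment> \<open>The lifetime is T = 1, the time at which coth \<rho> = 2 - t reaches 1.\<close>
  have "schroedinger_map_solution 1 spin (\<lambda>t x. spin_matrix (spin t x))"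
    unfolding schroedinger_map_solution_def
    using smooth_spin spin_time_derivative spin_in_hyperbolic_plane by auto
  moreover have "filterlim (\<lambda>t. grad_size (spin t) x) at_top (at_left 1)" if "x \<noteq> 0" for x
  proof (rule filterlim_at_top_mono)
    \<comment> \<open>Away from the origin the factor |x|/2 is a positive constant, so the lower
      bound inherits the divergence of \<open>amp\<close>.\<close>
    have "filterlim (\<lambda>t. norm x / 2 * (amp t)\<^sup>2) at_top (at_left 1)"
      using that by (intro filterlim_tendsto_pos_mult_at_top[OF tendsto_const _ amp_sqr_blowup]) simp
    then show "filterlim (\<lambda>t. (amp t)\<^sup>2 * norm x / 2) at_top (at_left 1)"
      by (simp add: mult_ac)
    show "\<forall>\<^sub>F t in at_left 1. (amp t)\<^sup>2 * norm x / 2 \<le> grad_size (spin t) x"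
      using grad_size_spin_ge by (auto simp: eventually_at_left_field intro!: exI[of _ 0])
  qed
  ultimately show ?thesis by (intro exI[of _ 1]) auto
qed

end
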